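(* Let $f$ be a continuous function on $[0,1]^2$. For every integer $n>1$ let $$I^n_{i,j}=\left[\frac{i-1}{2^n},\frac{i}{2^n}\right[\times\left[\frac{j-1}{2^n},\frac{j}{2^n}\right[\quad\text{for } i,j=1,\dots,2^n,$$ and define the functions $\underline{f}_n,\overline{f}_n$ on $[0,1[^2$ by $$\underline{f}_n(x,y)=\inf_{(u,v)\in I^n_{i,j}}f(u,v),\qquad \overline{f}_n(x,y)=\sup_{(u,v)\in I^n_{i,j}}f(u,v)\qquad\text{for all }(x,y)\in I^n_{i,j}.$$ Let $\underline{C}^n_{\max},\overline{C}^n_{\max}$ be copulas which attain $$\max_{C\in\mathcal{C}}\int_{[0,1[^2}\underline{f}_n(x,y)\,dC(x,y)\quad\text{and}\quad\max_{C\in\mathcal{C}}\int_{[0,1[^2}\overline{f}_n(x,y)\,dC(x,y),$$ respectively. Then $$\int_{[0,1[^2}\underline{f}_n\,d\underline{C}^n_{\max}\le\sup_{C\in\mathcal{C}}\int_{[0,1[^2}f\,dC\le\int_{[0,1[^2}\overline{f}_n\,d\overline{C}^n_{\max}$$ for every $n$, and $$\lim_{n\to\infty}\int_{[0,1[^2}\underline{f}_n\,d\underline{C}^n_{\max}=\lim_{n\to\infty}\int_{[0,1[^2}\overline{f}_n\,d\overline{C}^n_{\max}=\sup_{C\in\mathcal{C}}\int_{[0,1[^2}f\,dC.$$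
   Context: $[a,b[$ denotes the half-open interval $\{x:a\le x<b\}$. A (two-)copula is a non-negative function $C$ on the unit square $[0,1]^2$ with $C(x,0)=C(0,y)=0$, $C(x,1)=x$, $C(1,y)=y$ for all $x,y$, and $C(x_2,y_2)-C(x_2,y_1)-C(x_1,y_2)+C(x_1,y_1)\ge0$ whenever $x_1\le x_2$, $y_1\le y_2$. $\mathcal{C}$ is the set of all two-copulas. Integration $dC$ is with respect to the Borel probability measure on the unit square with distribution function $C$. Functions are real-valued. *)

theory Defs
  imports "HOL-Probability.Probability"
begin

abbreviation unit_square :: "(real \<times> real) set" where
  "unit_square \<equiv> {0..1} \<times> {0..1}"

text \<open>Only the values on the unit square matter; a total function standing for a copula is
  unconstrained outside of it.\<close>

definition copulas :: "(real \<times> real \<Rightarrow> real) set" where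
  "copulas = {C.
     (\<forall>p\<in>unit_square. 0 \<le> C p) \<and>
     (\<forall>x\<in>{0..1}. C (x, 0) = 0) \<and> (\<forall>y\<in>{0..1}. C (0, y) = 0) \<and>
     (\<forall>x\<in>{0..1}. C (x, 1) = x) \<and> (\<forall>y\<in>{0..1}. C (1, y) = y) \<and>
     (\<forall>x1\<in>{0..1}. \<forall>x2\<in>{0..1}. \<forall>y1\<in>{0..1}. \<forall>y2\<in>{0..1}.
        x1 \<le> x2 \<longrightarrow> y1 \<le> y2 \<longrightarrow> 0 \<le> C (x2, y2) - C (x2, y1) - C (x1, y2) + C (x1, y1))}"

text \<open>The Borel probability measure on the unit square with distribution function \<open>C\<close>. For a
  copula \<open>C\<close> there is exactly one: copulas are continuous, and the rectangles below generate the
  Borel sets of the square and are closed under intersection.\<close>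

definition copula_measure :: "(real \<times> real \<Rightarrow> real) \<Rightarrow> (real \<times> real) measure" where
  "copula_measure C = (THE M. prob_space M \<and> sets M = sets (restrict_space borel unit_square) \<and>
     (\<forall>x\<in>{0..1}. \<forall>y\<in>{0..1}. measure M ({0..x} \<times> {0..y}) = C (x, y)))"

definition copula_integral ::
    "(real \<times> real \<Rightarrow> real) \<Rightarrow> (real \<times> real \<Rightarrow> real) \<Rightarrow> real" where
  "copula_integral C f = (LINT p:{0..<1} \<times> {0..<1}|copula_measure C. f p)"

definition dyadic_square :: "nat \<Rightarrow> nat \<Rightarrow> nat \<Rightarrow> (real \<times> real) set" where
  "dyadic_square n i j =
     {(real i - 1) / 2 ^ n ..< real i / 2 ^ n} \<times> {(real j - 1) / 2 ^ n ..< real j / 2 ^ n}"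

end

theory Submission
  imports Defs
begin

text \<open>
  The measure of a copula \<open>C\<close> is obtained by disintegration. Since \<open>C\<close> is increasing and
  1-Lipschitz in each variable, \<open>x \<mapsto> C (x, q)\<close> has a density \<open>g q \<le> 1\<close> with respect to the uniform
  distribution, almost everywhere increasing in \<open>q \<in> \<rat>\<close>. If \<open>u\<close>, \<open>v\<close> are independent and uniform
  and \<open>S (u, v)\<close> is the generalised inverse of \<open>q \<mapsto> g q u\<close> at \<open>v\<close>, then \<open>(u, S (u, v))\<close> has the
  distribution function \<open>C\<close>.

  The limits follow because all copula measures are probability measures: the two step functions
  enclose \<open>f\<close>, and by uniform continuity they differ from it by at most \<open>e\<close> for large \<open>n\<close>, so that
  their integrals differ from that of \<open>f\<close> by at most \<open>e\<close> uniformly in \<open>C\<close>.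
\<close>

section \<open>Densities of distribution functions on the unit interval\<close>

text \<open>Clamping the argument extends \<open>F\<close> from the unit interval to the whole line
  by constants, as \<open>interval_measure\<close> works with functions on all reals.\<close>

definition unit_stieltjes :: "(real \<Rightarrow> real) \<Rightarrow> real measure" where
  "unit_stieltjes F = interval_measure (\<lambda>x. F (max 0 (min 1 x)))"

text \<open>The total mass \<open>F 1\<close> is left free: a section \<open>C (x, q)\<close> of a
  copula has mass \<open>q\<close>, and differences of sections occur as well.\<close>

definition unit_cdf :: "(real \<Rightarrow> real) \<Rightarrow> bool" where
  "unit_cdf F \<longleftrightarrow> continuous_on {0..1} F \<and> mono_on {0..1} F \<and> F 0 = 0"

lemma unit_cdf_extension:
  assumes "unit_cdf F"
  shows "\<And>x y. x \<le> y \<Longrightarrow> F (max 0 (min 1 x)) \<le> F (max 0 (min 1 y))"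
    and "\<And>a. continuous (at_right a) (\<lambda>x. F (max 0 (min 1 x)))"
    and "((\<lambda>x. F (max 0 (min 1 x))) \<longlongrightarrow> 0) at_bot"
    and "((\<lambda>x. F (max 0 (min 1 x))) \<longlongrightarrow> F 1) at_top"
    and "0 \<le> F 1"
proof -
  have cont: "continuous_on {0..1} F" and mono: "mono_on {0..1} F" and zero: "F 0 = 0"
    using assms by (auto simp: unit_cdf_def)
  show "F (max 0 (min 1 x)) \<le> F (max 0 (min 1 y))" if "x \<le> y" for x y
    by (rule mono_onD[OF mono]) (use that in auto)
  have "continuous_on UNIV (\<lambda>x. F (max 0 (min 1 x)))"
    by (rule continuous_on_compose2[OF cont]) (auto intro!: continuous_intros)
  then show "continuous (at_right a) (\<lambda>x. F (max 0 (min 1 x)))" for a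
    by (simp add: continuous_on_eq_continuous_at continuous_at_imp_continuous_within)
  show "((\<lambda>x. F (max 0 (min 1 x))) \<longlongrightarrow> 0) at_bot"
    by (rule tendsto_eventually) (auto simp: eventually_at_bot_linorder zero intro!: exI[of _ 0])
  show "((\<lambda>x. F (max 0 (min 1 x))) \<longlongrightarrow> F 1) at_top"
    by (rule tendsto_eventually) (auto simp: eventually_at_top_linorder intro!: exI[of _ 1])
  show "0 \<le> F 1"
    using mono_onD[OF mono, of 0 1] zero by simp
qed

lemma sets_unit_stieltjes [simp, measurable_cong]: "sets (unit_stieltjes F) = sets borel"
  and space_unit_stieltjes [simp]: "space (unit_stieltjes F) = UNIV"
  by (simp_all add: unit_stieltjes_def)

lemma
  assumes "unit_cdf F"
  shows finite_borel_measure_unit_stieltjes: "finite_borel_measure (unit_stieltjes F)"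
    and emeasure_unit_stieltjes_Iic: "emeasure (unit_stieltjes F) {..x} = F (max 0 (min 1 x))"
  unfolding unit_stieltjes_def
  using finite_borel_measure_interval_measure[OF unit_cdf_extension[OF assms]]
    emeasure_interval_measure_Iic[OF unit_cdf_extension(1-3)[OF assms]] by auto

lemma unit_cdf_nonneg: "unit_cdf F \<Longrightarrow> x \<in> {0..1} \<Longrightarrow> 0 \<le> F x"
  unfolding unit_cdf_def by (metis atLeastAtMost_iff mono_onD order_refl zero_le_one)

text \<open>The sum of the two measures, built below as \<open>N\<close>, is a finite Borel measure
  with the distribution function of the left-hand side, and a distribution function determines its
  finite Borel measure.\<close>

lemma emeasure_unit_stieltjes_add:
  assumes F: "unit_cdf F" and G: "unit_cdf G" and A: "A \<in> sets borel"
  shows "emeasure (unit_stieltjes (\<lambda>x. F x + G x)) A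
    = emeasure (unit_stieltjes F) A + emeasure (unit_stieltjes G) A"
proof -
  interpret F: finite_borel_measure "unit_stieltjes F"
    by (rule finite_borel_measure_unit_stieltjes[OF F])
  interpret G: finite_borel_measure "unit_stieltjes G"
    by (rule finite_borel_measure_unit_stieltjes[OF G])
  have H: "unit_cdf (\<lambda>x. F x + G x)"
    using F G by (auto simp: unit_cdf_def mono_on_def intro!: continuous_intros add_mono)
  define N where "N = measure_of UNIV (sets borel)
    (\<lambda>A. emeasure (unit_stieltjes F) A + emeasure (unit_stieltjes G) A)"
  have sets_N: "sets N = sets borel"
    unfolding N_def using sets.sigma_sets_eq[of borel] by (simp add: sets_measure_of_conv)
  have em_N: "emeasure N B = emeasure (unit_stieltjes F) B + emeasure (unit_stieltjes G) B"
    if "B \<in> sets borel" for B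
    unfolding N_def
  proof (rule emeasure_measure_of_sigma)
    show "sigma_algebra UNIV (sets borel)"
      using sets.sigma_algebra_axioms[of borel] by simp
    show "countably_additive (sets borel)
        (\<lambda>A. emeasure (unit_stieltjes F) A + emeasure (unit_stieltjes G) A)"
    proof (rule countably_additiveI)
      fix X :: "nat \<Rightarrow> real set" assume X: "range X \<subseteq> sets borel" "disjoint_family X"
      have "(\<Sum>i. emeasure (unit_stieltjes F) (X i)) = emeasure (unit_stieltjes F) (\<Union>i. X i)"
        "(\<Sum>i. emeasure (unit_stieltjes G) (X i)) = emeasure (unit_stieltjes G) (\<Union>i. X i)"
        using X by (auto intro!: suminf_emeasure)
      then show "(\<Sum>i. emeasure (unit_stieltjes F) (X i) + emeasure (unit_stieltjes G) (X i))
        = emeasure (unit_stieltjes F) (\<Union>i. X i) + emeasure (unit_stieltjes G) (\<Union>i. X i)"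
        by (subst suminf_add[symmetric]) auto
    qed
  qed (use that in \<open>auto simp: positive_def\<close>)
  have fin_N: "finite_borel_measure N"
  proof (intro finite_borel_measure.intro finite_measureI finite_borel_measure_axioms.intro)
    show "emeasure N (space N) \<noteq> \<infinity>"
      using em_N[of UNIV] F.emeasure_finite[of UNIV] G.emeasure_finite[of UNIV]
        sets_eq_imp_space_eq[OF sets_N] by simp
  qed (rule sets_N)
  have "unit_stieltjes (\<lambda>x. F x + G x) = N"
  proof (rule cdf_unique'[OF finite_borel_measure_unit_stieltjes[OF H] fin_N])
    have "emeasure (unit_stieltjes (\<lambda>x. F x + G x)) {..x} = emeasure N {..x}" for x
      by (simp add: em_N emeasure_unit_stieltjes_Iic F G H unit_cdf_nonneg ennreal_plus)
    then show "cdf (unit_stieltjes (\<lambda>x. F x + G x)) = cdf N"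
      by (simp add: cdf_def measure_def fun_eq_iff)
  qed
  then show ?thesis
    using em_N[OF A] by simp
qed

abbreviation "unit_uniform \<equiv> unit_stieltjes (\<lambda>x. x)"

lemma unit_cdf_id: "unit_cdf (\<lambda>x. x)"
  by (auto simp: unit_cdf_def mono_on_def)

lemma unit_cdf_diff:
  assumes "unit_cdf F" "unit_cdf G" "mono_on {0..1} (\<lambda>x. G x - F x)"
  shows "unit_cdf (\<lambda>x. G x - F x)"
  using assms by (auto simp: unit_cdf_def intro!: continuous_intros)

text \<open>Additivity applied to \<open>G = F + (G - F)\<close>. This turns domination of
  increments into domination of measures, for absolute continuity and for the comparison of
  densities.\<close>

lemma emeasure_unit_stieltjes_diff:
  assumes "unit_cdf F" "unit_cdf G" "mono_on {0..1} (\<lambda>x. G x - F x)" "A \<in> sets borel"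
  shows "emeasure (unit_stieltjes F) A + emeasure (unit_stieltjes (\<lambda>x. G x - F x)) A
    = emeasure (unit_stieltjes G) A"
  using emeasure_unit_stieltjes_add[OF assms(1) unit_cdf_diff[OF assms(1-3)] assms(4)] by simp

text \<open>Monotonicity of \<open>x - F x\<close> says that increments of \<open>F\<close> are at
  most those of the identity. Hence the uniform distribution dominates the measure of
  \<open>F\<close>, and Radon-Nikodym applies.\<close>

lemma unit_stieltjes_density:
  assumes F: "unit_cdf F" and lip: "mono_on {0..1} (\<lambda>x. x - F x)"
  obtains f where "f \<in> borel_measurable borel" "density unit_uniform f = unit_stieltjes F"
proof -
  interpret L: finite_borel_measure unit_uniform
    by (rule finite_borel_measure_unit_stieltjes[OF unit_cdf_id])
  have "absolutely_continuous unit_uniform (unit_stieltjes F)"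
    unfolding absolutely_continuous_def
  proof
    fix A assume "A \<in> null_sets unit_uniform"
    then have A: "A \<in> sets borel" "emeasure unit_uniform A = 0" by auto
    then show "A \<in> null_sets (unit_stieltjes F)"
      using emeasure_unit_stieltjes_diff[OF F unit_cdf_id lip A(1)] by (auto intro!: null_setsI)
  qed
  from L.Radon_Nikodym[OF this] obtain f
    where "f \<in> borel_measurable unit_uniform" "density unit_uniform f = unit_stieltjes F"
    by auto
  then show thesis
    using that measurable_cong_sets[OF sets_unit_stieltjes refl] by blast
qed

text \<open>The difference \<open>G - F\<close> has a density \<open>h\<close> of its own, with
  values in \<open>ennreal\<close> and so nonnegative. Then \<open>f + h\<close> is a density for
  \<open>G\<close>, and uniqueness of densities gives \<open>f + h = g\<close> almost
  everywhere.\<close>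

lemma unit_stieltjes_density_mono:
  assumes F: "unit_cdf F" and G: "unit_cdf G"
    and FG: "mono_on {0..1} (\<lambda>x. G x - F x)" and G_lip: "mono_on {0..1} (\<lambda>x. x - G x)"
    and f [measurable]: "f \<in> borel_measurable borel" and df: "density unit_uniform f = unit_stieltjes F"
    and g [measurable]: "g \<in> borel_measurable borel" and dg: "density unit_uniform g = unit_stieltjes G"
  shows "AE x in unit_uniform. f x \<le> g x"
proof -
  interpret L: finite_borel_measure unit_uniform
    by (rule finite_borel_measure_unit_stieltjes[OF unit_cdf_id])
  \<comment> \<open>The function equals \<open>(x - G x) + F x\<close>, a sum of two increasing
    functions.\<close>
  have "mono_on {0..1} (\<lambda>x. x - (G x - F x))"
  proof (rule mono_onI)
    fix r s :: real assume rs: "r \<in> {0..1}" "s \<in> {0..1}" "r \<le> s"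
    have "F r \<le> F s" using F rs by (auto simp: unit_cdf_def mono_on_def)
    moreover have "r - G r \<le> s - G s" using mono_onD[OF G_lip rs] .
    ultimately show "r - (G r - F r) \<le> s - (G s - F s)" by simp
  qed
  then obtain h where h [measurable]: "h \<in> borel_measurable borel"
    and dh: "density unit_uniform h = unit_stieltjes (\<lambda>x. G x - F x)"
    using unit_stieltjes_density[OF unit_cdf_diff[OF F G FG]] by blast
  have "density unit_uniform (\<lambda>x. f x + h x) = density unit_uniform g"
  proof (rule measure_eqI)
    fix A assume "A \<in> sets (density unit_uniform (\<lambda>x. f x + h x))"
    then have A: "A \<in> sets borel" by simp
    have "emeasure (density unit_uniform (\<lambda>x. f x + h x)) A
      = emeasure (density unit_uniform f) A + emeasure (density unit_uniform h) A"
      using A by (simp add: emeasure_density nn_integral_add distrib_right)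
    also have "\<dots> = emeasure (density unit_uniform g) A"
      using emeasure_unit_stieltjes_diff[OF F G FG A] by (simp add: df dg dh)
    finally show "emeasure (density unit_uniform (\<lambda>x. f x + h x)) A
      = emeasure (density unit_uniform g) A" .
  qed simp
  then have "AE x in unit_uniform. f x + h x = g x"
    by (subst (asm) L.density_unique_iff) auto
  then show ?thesis
    by eventually_elim (metis add_increasing2 order_refl zero_le)
qed

text \<open>The construction of a copula measure sends the first coordinate through the clamp in
  order to land in the unit square. The clamped sublevel set is \<open>{..x}\<close> for
  \<open>x < 1\<close> but the whole line for \<open>x = 1\<close>.\<close>

lemma emeasure_unit_stieltjes_clamp:
  assumes F: "unit_cdf F" and x: "x \<in> {0..1}"
  shows "emeasure (unit_stieltjes F) {u. max 0 (min 1 u) \<le> x} = F x"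
proof (cases "x = 1")
  case True
  interpret finite_borel_measure "unit_stieltjes F"
    by (rule finite_borel_measure_unit_stieltjes[OF F])
  have "emeasure (unit_stieltjes F) UNIV = F 1"
    unfolding unit_stieltjes_def by (rule interval_measure_UNIV) (use unit_cdf_extension[OF F] in auto)
  then show ?thesis using True by simp
next
  case False
  then have "{u. max 0 (min 1 u) \<le> x} = {..x}" using x by auto
  then show ?thesis using x by (simp add: emeasure_unit_stieltjes_Iic[OF F])
qed

lemma prob_space_unit_uniform: "prob_space unit_uniform"
  using emeasure_unit_stieltjes_clamp[OF unit_cdf_id, of 1] by (intro prob_spaceI) simp

section \<open>The measure of a copula\<close>

lemma copulasD:
  assumes "C \<in> copulas" and "x \<in> {0..1}"
  shows "C (x, 0) = 0" "C (0, x) = 0" "C (x, 1) = x" "C (1, x) = x"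
  using assms by (auto simp: copulas_def)

lemma copulas_rectangle:
  assumes "C \<in> copulas" "x1 \<in> {0..1}" "x2 \<in> {0..1}" "y1 \<in> {0..1}" "y2 \<in> {0..1}" "x1 \<le> x2" "y1 \<le> y2"
  shows "C (x1, y2) - C (x1, y1) \<le> C (x2, y2) - C (x2, y1)"
proof -
  have "0 \<le> C (x2, y2) - C (x2, y1) - C (x1, y2) + C (x1, y1)"
    using assms unfolding copulas_def by blast
  then show ?thesis by simp
qed

lemma copulas_mono_diff:
  assumes "C \<in> copulas" "q \<in> {0..1}" "r \<in> {0..1}" "q \<le> r"
  shows "mono_on {0..1} (\<lambda>x. C (x, r) - C (x, q))"
  using assms by (intro mono_onI copulas_rectangle) auto

text \<open>The preceding monotonicity at the upper level \<open>1\<close>, where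
  \<open>C (x, 1) = x\<close>. With monotonicity of \<open>C (x, q)\<close> it makes the sections
  1-Lipschitz.\<close>

lemma copulas_mono_id_diff:
  assumes "C \<in> copulas" "q \<in> {0..1}"
  shows "mono_on {0..1} (\<lambda>x. x - C (x, q))"
  using copulas_mono_diff[OF assms, of 1] copulasD(3)[OF assms(1)] assms(2)
  by (auto simp: mono_on_def)

lemma unit_cdf_copula:
  assumes C: "C \<in> copulas" and q: "q \<in> {0..1}"
  shows "unit_cdf (\<lambda>x. C (x, q))"
proof -
  have mono: "mono_on {0..1} (\<lambda>x. C (x, q))"
    using copulas_mono_diff[OF C _ q, of 0] copulasD(1)[OF C] q by (auto simp: mono_on_def)
  have "1-lipschitz_on {0..1} (\<lambda>x. C (x, q))"
  proof (rule lipschitz_onI)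
    show "dist (C (x, q)) (C (y, q)) \<le> 1 * dist x y" if "x \<in> {0..1}" "y \<in> {0..1}" for x y
      using mono_onD[OF mono that] mono_onD[OF mono that(2,1)]
        mono_onD[OF copulas_mono_id_diff[OF C q] that]
        mono_onD[OF copulas_mono_id_diff[OF C q] that(2,1)]
      by (cases "x \<le> y") (auto simp: dist_real_def)
  qed simp
  then show ?thesis
    using mono copulasD(2)[OF C q] by (auto simp: unit_cdf_def lipschitz_on_continuous_on)
qed

text \<open>The rectangle inequality on \<open>[0, x] * [q, r]\<close> and on
  \<open>[x, 1] * [q, r]\<close>. The Lipschitz bound later carries the distribution function from
  rational to real levels.\<close>

lemma copulas_snd_bounds:
  assumes C: "C \<in> copulas" "x \<in> {0..1}" "q \<in> {0..1}" "r \<in> {0..1}" "q \<le> r"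
  shows "C (x, q) \<le> C (x, r)" "C (x, r) \<le> C (x, q) + (r - q)"
  using copulas_rectangle[OF C(1), of 0 x q r] copulas_rectangle[OF C(1), of x 1 q r] C
    copulasD[OF C(1)] by auto

text \<open>Since \<open>ennreal\<close> sends negative reals to 0, the set is a full half-line
  \<open>{..s}\<close>, whose uniform measure is \<open>s\<close>.\<close>

lemma emeasure_unit_uniform_le:
  assumes "t \<le> 1"
  shows "emeasure unit_uniform {v. ennreal v \<le> t} = t"
proof -
  obtain s where s: "0 \<le> s" "t = ennreal s"
    using assms by (cases t) (auto simp: top_unique)
  then have "s \<le> 1" using assms by simp
  have "{v. ennreal v \<le> t} = {..s}"
    using s by (auto simp: ennreal_le_iff2)
  then show ?thesis
    using s \<open>s \<le> 1\<close> by (simp add: emeasure_unit_stieltjes_Iic[OF unit_cdf_id])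
qed

text \<open>The event \<open>S p \<le> y\<close> is squeezed between level events at rational
  \<open>q \<le> y\<close> and \<open>r > y\<close>, of probabilities \<open>C (x, q)\<close> and
  \<open>C (x, r)\<close> once the first coordinate is restricted to \<open>[0, x]\<close>. The
  Lipschitz bound in the second variable closes the gap.\<close>

lemma copula_measure_exists:
  assumes C: "C \<in> copulas"
  shows "\<exists>M. prob_space M \<and> sets M = sets (restrict_space borel unit_square) \<and>
     (\<forall>x\<in>{0..1}. \<forall>y\<in>{0..1}. measure M ({0..x} \<times> {0..y}) = C (x, y))"
proof -
  let ?L = unit_uniform
  \<comment> \<open>Countability of the levels lets the almost-everywhere inequalities hold
    simultaneously and makes the infimum \<open>S\<close> measurable.\<close>
  define Q where "Q = \<rat> \<inter> {0..1::real}"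
  have Q: "countable Q" "0 \<in> Q" "1 \<in> Q" "\<And>q. q \<in> Q \<Longrightarrow> q \<in> {0..1}"
    by (auto simp: Q_def countable_rat)
  interpret L: prob_space ?L by (rule prob_space_unit_uniform)
  interpret P: pair_prob_space ?L ?L ..
  have "\<forall>q\<in>Q. \<exists>g. g \<in> borel_measurable borel \<and> density ?L g = unit_stieltjes (\<lambda>x. C (x, q))"
    using unit_stieltjes_density[OF unit_cdf_copula[OF C Q(4)] copulas_mono_id_diff[OF C Q(4)]]
    by metis
  then obtain g where g_meas [measurable]: "\<And>q. q \<in> Q \<Longrightarrow> g q \<in> borel_measurable borel"
    and g: "\<And>q. q \<in> Q \<Longrightarrow> density ?L (g q) = unit_stieltjes (\<lambda>x. C (x, q))"
    by metis
  have g_mono: "AE u in ?L. g q u \<le> g r u" if "q \<in> Q" "r \<in> Q" "q \<le> r" for q r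
    using that Q(4) by (intro unit_stieltjes_density_mono[OF unit_cdf_copula[OF C, of q]
          unit_cdf_copula[OF C, of r] copulas_mono_diff[OF C] copulas_mono_id_diff[OF C]]
        g g_meas) auto
  \<comment> \<open>The constant 1 is the density of the uniform distribution, so this is the
    comparison of densities with the identity as \<open>G\<close>.\<close>
  have g_le_1: "AE u in ?L. g q u \<le> 1" if "q \<in> Q" for q
    using that Q(4) by (intro unit_stieltjes_density_mono[OF unit_cdf_copula[OF C, of q]
          unit_cdf_id copulas_mono_id_diff[OF C]] g g_meas)
      (auto simp: density_1 mono_on_def)
  define clamp where "clamp u = max 0 (min 1 u)" for u :: real
  have clamp_meas [measurable]: "clamp \<in> borel_measurable borel"
    unfolding clamp_def by measurable
  have Icc_meas [measurable]: "{p. clamp (fst p) \<le> x \<and> ennreal (snd p) \<le> g q (fst p)} \<in> sets (?L \<Otimes>\<^sub>M ?L)"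
    if [measurable]: "q \<in> Q" for q x
  proof -
    have "Measurable.pred (?L \<Otimes>\<^sub>M ?L) (\<lambda>p. clamp (fst p) \<le> x \<and> ennreal (snd p) \<le> g q (fst p))"
      by measurable
    then show ?thesis by (simp add: pred_def space_pair_measure)
  qed
  \<comment> \<open>By Fubini: because \<open>g q u \<le> 1\<close>, the fibre over \<open>u\<close>
    has measure \<open>g q u\<close>, and integrating this density over
    \<open>clamp u \<le> x\<close> returns the section of \<open>C\<close>.\<close>
  have level: "emeasure (?L \<Otimes>\<^sub>M ?L) {p. clamp (fst p) \<le> x \<and> ennreal (snd p) \<le> g q (fst p)} = C (x, q)"
    if q: "q \<in> Q" and x: "x \<in> {0..1}" for q x
  proof -
    let ?A = "{u. clamp u \<le> x}"
    have [measurable]: "?A \<in> sets borel" by measurable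
    have "emeasure (?L \<Otimes>\<^sub>M ?L) {p. clamp (fst p) \<le> x \<and> ennreal (snd p) \<le> g q (fst p)}
      = (\<integral>\<^sup>+u. emeasure ?L {v. clamp u \<le> x \<and> ennreal v \<le> g q u} \<partial>?L)"
      using Icc_meas[OF q] by (subst L.emeasure_pair_measure_alt) (simp_all add: vimage_def)
    also have "\<dots> = (\<integral>\<^sup>+u. g q u * indicator ?A u \<partial>?L)"
    proof (rule nn_integral_cong_AE)
      show "AE u in ?L. emeasure ?L {v. clamp u \<le> x \<and> ennreal v \<le> g q u} = g q u * indicator ?A u"
        using g_le_1[OF q]
        by eventually_elim (auto simp: emeasure_unit_uniform_le indicator_def)
    qed
    also have "\<dots> = emeasure (unit_stieltjes (\<lambda>x. C (x, q))) ?A"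
      using q by (subst g[symmetric]) (simp_all add: emeasure_density)
    also have "\<dots> = C (x, q)"
      using emeasure_unit_stieltjes_clamp[OF unit_cdf_copula[OF C Q(4)[OF q]] x]
      by (simp add: clamp_def)
    finally show ?thesis .
  qed
  \<comment> \<open>The inserted 1 is the default value when no level reaches \<open>snd p\<close>;
    it keeps the infimum over a nonempty set and inside \<open>[0, 1]\<close>.\<close>
  define S where "S p = Inf (insert 1 {q \<in> Q. ennreal (snd p) \<le> g q (fst p)})" for p
  have bdd: "bdd_below (insert 1 {q \<in> Q. ennreal (snd p) \<le> g q (fst p)})" for p
    using Q(4) by (auto intro!: bdd_belowI[of _ 0])
  have S_range: "0 \<le> S p" "S p \<le> 1" for p
    unfolding S_def using Q(4) by (auto intro!: cInf_greatest cInf_lower bdd)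
  have S_le: "S p \<le> q" if "q \<in> Q" "ennreal (snd p) \<le> g q (fst p)" for p q
    unfolding S_def using that by (intro cInf_lower bdd) auto
  \<comment> \<open>With a strict inequality the infimum becomes a countable existential, which
    yields measurability now and the upper bound later.\<close>
  have S_less: "S p < y \<longleftrightarrow> 1 < y \<or> (\<exists>q\<in>Q. q < y \<and> ennreal (snd p) \<le> g q (fst p))" for p y
    unfolding S_def by (subst cInf_less_iff[OF _ bdd]) auto
  have S_meas [measurable]: "S \<in> borel_measurable (?L \<Otimes>\<^sub>M ?L)"
  proof -
    have "Measurable.pred (?L \<Otimes>\<^sub>M ?L) (\<lambda>p. S p < y)" for y
      unfolding S_less using Q(1) by measurable
    then show ?thesis
      by (simp add: borel_measurable_iff_less pred_def)
  qed
  let ?T = "\<lambda>p. (clamp (fst p), S p)"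
  have T: "?T \<in> measurable (?L \<Otimes>\<^sub>M ?L) (restrict_space borel unit_square)"
    using S_range by (intro measurable_restrict_space2) (auto simp: clamp_def)
  define M where "M = distr (?L \<Otimes>\<^sub>M ?L) (restrict_space borel unit_square) ?T"
  have "measure M ({0..x} \<times> {0..y}) = C (x, y)" if x: "x \<in> {0..1}" and y: "y \<in> {0..1}" for x y
  proof -
    let ?E = "{p. clamp (fst p) \<le> x \<and> S p \<le> y}"
    have rect: "{0..x} \<times> {0..y} \<in> sets (restrict_space borel unit_square)"
      using x y by (auto simp: sets_restrict_space_iff borel_Times)
    have E [measurable]: "?E \<in> sets (?L \<Otimes>\<^sub>M ?L)"
    proof -
      have "Measurable.pred (?L \<Otimes>\<^sub>M ?L) (\<lambda>p. clamp (fst p) \<le> x \<and> S p \<le> y)"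
        by measurable
      then show ?thesis by (simp add: pred_def space_pair_measure)
    qed
    have M_E: "measure M ({0..x} \<times> {0..y}) = P.prob ?E"
      unfolding M_def using S_range
      by (subst measure_distr[OF T rect])
        (auto intro!: arg_cong[where f = P.prob] simp: space_pair_measure clamp_def)
    have level': "P.prob {p. clamp (fst p) \<le> x \<and> ennreal (snd p) \<le> g q (fst p)} = C (x, q)"
      if "q \<in> Q" for q
      using level[OF that x] unit_cdf_nonneg[OF unit_cdf_copula[OF C Q(4)[OF that]] x]
      by (simp add: measure_def)
    have lower: "C (x, q) \<le> P.prob ?E" if q: "q \<in> Q" "q \<le> y" for q
    proof -
      have "{p. clamp (fst p) \<le> x \<and> ennreal (snd p) \<le> g q (fst p)} \<subseteq> ?E"
        using S_le[OF q(1)] q(2) by force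
      then show ?thesis
        unfolding level'[OF q(1), symmetric] by (rule P.finite_measure_mono[OF _ E])
    qed
    \<comment> \<open>Strictness of \<open>y < r\<close> provides a level \<open>q < r\<close>
      reaching \<open>snd p\<close>; almost everywhere \<open>g q \<le> g r\<close>, so level
      \<open>r\<close> reaches it too.\<close>
    have upper: "P.prob ?E \<le> C (x, r)" if r: "r \<in> Q" "y < r" for r
    proof -
      have "AE u in ?L. \<forall>q\<in>Q. q \<le> r \<longrightarrow> g q u \<le> g r u"
        using g_mono r(1) Q(1) by (auto simp: AE_ball_countable)
      then have "AE p in ?L \<Otimes>\<^sub>M ?L. \<forall>q\<in>Q. q \<le> r \<longrightarrow> g q (fst p) \<le> g r (fst p)"
      proof (intro P.AE_pair_measure)
        show "{p \<in> space (?L \<Otimes>\<^sub>M ?L). \<forall>q\<in>Q. q \<le> r \<longrightarrow> g q (fst p) \<le> g r (fst p)}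
            \<in> sets (?L \<Otimes>\<^sub>M ?L)"
          using Q(1) r(1) by measurable
      qed simp
      then have "AE p in ?L \<Otimes>\<^sub>M ?L. p \<in> ?E \<longrightarrow>
          p \<in> {p. clamp (fst p) \<le> x \<and> ennreal (snd p) \<le> g r (fst p)}"
      proof eventually_elim
        case (elim p)
        show ?case
        proof
          assume p: "p \<in> ?E"
          then have "S p < r" using r by simp
          then obtain q where "q \<in> Q" "q < r" "ennreal (snd p) \<le> g q (fst p)"
            using S_less Q(4)[OF r(1)] by auto
          then show "p \<in> {p. clamp (fst p) \<le> x \<and> ennreal (snd p) \<le> g r (fst p)}"
            using elim p by (auto intro: order_trans)
        qed
      qed
      from P.finite_measure_mono_AE[OF this Icc_meas[OF r(1)]] show ?thesis
        using level'[OF r(1)] by simp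
    qed
    have "C (x, y) \<le> P.prob ?E"
    proof (rule field_le_epsilon)
      fix e :: real assume e: "0 < e"
      \<comment> \<open>At \<open>y = 0\<close> there is no level strictly below, but 0 is itself a
        level.\<close>
      obtain q where q: "q \<in> Q" "q \<le> y" "y - e \<le> q"
      proof (cases "y = 0")
        case True
        then show thesis using that[of 0] Q(2) e by auto
      next
        case False
        then have "max 0 (y - e) < y" using y e by auto
        from Rats_dense_in_real[OF this] obtain q where "q \<in> \<rat>" "max 0 (y - e) < q" "q < y" by auto
        then show thesis using that[of q] y by (auto simp: Q_def)
      qed
      then show "C (x, y) \<le> P.prob ?E + e"
        using lower[OF q(1,2)] copulas_snd_bounds(2)[OF C x Q(4)[OF q(1)] y q(2)] by simp
    qed
    moreover have "P.prob ?E \<le> C (x, y)"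
    \<comment> \<open>No level lies above 1. There \<open>S p \<le> 1\<close> always holds, so the
      event only restricts the first coordinate and has probability \<open>x\<close>.\<close>
    proof (cases "y = 1")
      case True
      have "emeasure (?L \<Otimes>\<^sub>M ?L) ?E = emeasure (?L \<Otimes>\<^sub>M ?L) ({u. clamp u \<le> x} \<times> UNIV)"
        using S_range True by (intro arg_cong[where f = "emeasure _"]) auto
      also have "\<dots> = x"
        using emeasure_unit_stieltjes_clamp[OF unit_cdf_id x] L.emeasure_space_1
        by (subst L.emeasure_pair_measure_Times) (auto simp: clamp_def)
      finally show ?thesis
        using x True copulasD(3)[OF C x] by (simp add: measure_def)
    next
      case False
      show ?thesis
      proof (rule field_le_epsilon)
        fix e :: real assume e: "0 < e"
        have "y < min 1 (y + e)" using False y e by auto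
        from Rats_dense_in_real[OF this] obtain r where r': "r \<in> \<rat>" "y < r" "r < min 1 (y + e)" by auto
        then have r: "r \<in> Q" "y \<le> r" using y by (auto simp: Q_def)
        show "P.prob ?E \<le> C (x, y) + e"
          using upper[OF r(1) r'(2)] copulas_snd_bounds(2)[OF C x y Q(4)[OF r(1)] r(2)] r'(3) by simp
      qed
    qed
    ultimately show ?thesis using M_E by simp
  qed
  moreover have "prob_space M"
    unfolding M_def by (rule P.prob_space_distr[OF T])
  ultimately show ?thesis
    by (intro exI[of _ M]) (simp add: M_def)
qed

text \<open>Both measures are pushed to the whole plane, where the quadrants
  \<open>{..(a, b)}\<close> are an intersection-stable generator. A quadrant meets the unit square
  in the empty set or in a rectangle covered by \<open>eq\<close>.\<close>

lemma copula_measure_unique: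
  assumes "prob_space M" "prob_space N"
    and M: "sets M = sets (restrict_space borel unit_square)"
    and N: "sets N = sets (restrict_space borel unit_square)"
    and eq: "\<And>x y. x \<in> {0..1} \<Longrightarrow> y \<in> {0..1} \<Longrightarrow>
      measure M ({0..x} \<times> {0..y}) = measure N ({0..x} \<times> {0..y})"
  shows "M = N"
proof -
  interpret M: prob_space M by fact
  interpret N: prob_space N by fact
  have space: "space M = unit_square" "space N = unit_square"
    using M N by (auto dest!: sets_eq_imp_space_eq simp: space_restrict_space)
  have "id \<in> measurable (restrict_space borel unit_square) borel"
    by (intro measurable_restrict_space1) simp
  then have id [measurable]: "id \<in> borel_measurable M" "id \<in> borel_measurable N"
    by (simp_all add: measurable_cong_sets[OF M] measurable_cong_sets[OF N])
  have "distr M borel id = distr N borel id"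
  proof (rule measure_eqI_generator_eq[where E = "range atMost" and \<Omega> = UNIV
        and A = "\<lambda>n. {..(real n, real n)}"])
    show "Int_stable (range (atMost :: real \<times> real \<Rightarrow> _))"
    proof (rule Int_stableI_image)
      show "\<exists>c\<in>UNIV. {..a} \<inter> {..b} = {..c}" for a b :: "real \<times> real"
        by (rule bexI[of _ "inf a b"]) auto
    qed
    show "sets (distr M borel id) = sigma_sets UNIV (range atMost)"
      "sets (distr N borel id) = sigma_sets UNIV (range atMost)"
      by (simp_all add: borel_eq_atMost)
    show "(\<Union>n. {..(real n, real n)}) = UNIV"
    proof (rule UNIV_eq_I[symmetric])
      fix p :: "real \<times> real"
      obtain n where "max (fst p) (snd p) \<le> real n"
        using real_arch_simple by blast
      then show "p \<in> (\<Union>n. {..(real n, real n)})"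
        by (auto simp: less_eq_prod_def intro!: exI[of _ n])
    qed
    show "emeasure (distr M borel id) {..(real n, real n)} \<noteq> \<infinity>" for n
      by (simp add: emeasure_distr)
    fix X assume "X \<in> range (atMost :: real \<times> real \<Rightarrow> _)"
    then obtain a b where X: "X = {..(a, b)}" by auto
    have "X \<inter> unit_square = (if 0 \<le> a \<and> 0 \<le> b then {0..min a 1} \<times> {0..min b 1} else {})"
      by (auto simp: X less_eq_prod_def)
    then have "measure M (X \<inter> unit_square) = measure N (X \<inter> unit_square)"
      by (cases "0 \<le> a \<and> 0 \<le> b") (simp_all add: eq)
    then show "emeasure (distr M borel id) X = emeasure (distr N borel id) X"
      by (simp add: X emeasure_distr space M.emeasure_eq_measure N.emeasure_eq_measure)
  qed (auto simp: emeasure_distr)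
  then have distr: "emeasure (distr M borel id) A = emeasure (distr N borel id) A" for A
    by simp
  show "M = N"
  proof (rule measure_eqI)
    fix A assume "A \<in> sets M"
    then have "A \<in> sets borel" "A \<subseteq> unit_square"
      by (auto simp: M sets_restrict_space_iff borel_Times)
    then show "emeasure M A = emeasure N A"
      using distr[of A] by (simp add: emeasure_distr space Int_absorb2)
  qed (simp add: M N)
qed

text \<open>Existence and uniqueness together make the definite description in
  \<open>copula_measure\<close> denote the intended measure.\<close>

lemma
  assumes C: "C \<in> copulas"
  shows prob_space_copula_measure: "prob_space (copula_measure C)"
    and sets_copula_measure: "sets (copula_measure C) = sets (restrict_space borel unit_square)"
proof -
  let ?P = "\<lambda>M. prob_space M \<and> sets M = sets (restrict_space borel unit_square) \<and>
     (\<forall>x\<in>{0..1}. \<forall>y\<in>{0..1}. measure M ({0..x} \<times> {0..y}) = C (x, y))"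
  have "\<exists>!M. ?P M"
    using copula_measure_exists[OF C]
  proof (elim ex_ex1I)
    show "M = N" if "?P M" "?P N" for M N
      by (rule copula_measure_unique) (use that in auto)
  qed
  then have "?P (copula_measure C)"
    unfolding copula_measure_def by (rule theI')
  then show "prob_space (copula_measure C)"
    and "sets (copula_measure C) = sets (restrict_space borel unit_square)"
    by auto
qed

section \<open>Integrability and comparison of integrals over the half-open square\<close>

abbreviation half_open_square :: "(real \<times> real) set" where
  "half_open_square \<equiv> {0..<1} \<times> {0..<1}"

lemma half_open_square_sets:
  assumes "C \<in> copulas"
  shows "half_open_square \<in> sets (copula_measure C)"
  by (auto simp: sets_copula_measure[OF assms] sets_restrict_space_iff borel_Times)

text \<open>The step functions are specified only on the half-open square. Measurability is
  therefore borrowed from a function \<open>g\<close> agreeing with \<open>h\<close> there;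
  boundedness and finite mass give integrability.\<close>

lemma set_integrable_copula_measure:
  fixes g h :: "real \<times> real \<Rightarrow> real"
  assumes C: "C \<in> copulas" and g: "g \<in> borel_measurable (restrict_space borel unit_square)"
    and h: "\<And>p. p \<in> half_open_square \<Longrightarrow> h p = g p"
    and B: "\<And>p. p \<in> half_open_square \<Longrightarrow> \<bar>h p\<bar> \<le> B"
  shows "set_integrable (copula_measure C) half_open_square h"
proof -
  interpret prob_space "copula_measure C" by (rule prob_space_copula_measure[OF C])
  have "g \<in> borel_measurable (copula_measure C)"
    using g by (simp add: measurable_cong_sets[OF sets_copula_measure[OF C]])
  then have "(\<lambda>p. indicator half_open_square p *\<^sub>R g p) \<in> borel_measurable (copula_measure C)"
    using half_open_square_sets[OF C] by measurable
  then have "(\<lambda>p. indicator half_open_square p *\<^sub>R h p) \<in> borel_measurable (copula_measure C)"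
    by (rule measurable_cong[THEN iffD1, rotated]) (auto simp: h indicator_def)
  then show ?thesis
    unfolding set_integrable_def
    by (rule integrable_const_bound[rotated, where B = "max B 0"])
      (use B in \<open>auto simp: indicator_def intro: max.coboundedI1\<close>)
qed

text \<open>The half-open square has mass at most 1, so the constant \<open>e\<close> contributes at
  most \<open>e\<close>, uniformly in \<open>C\<close>. The case \<open>e = 0\<close> serves as
  monotonicity.\<close>

lemma copula_integral_le_add:
  assumes C: "C \<in> copulas"
    and g: "set_integrable (copula_measure C) half_open_square g"
    and h: "set_integrable (copula_measure C) half_open_square h"
    and e: "0 \<le> e" and le: "\<And>p. p \<in> half_open_square \<Longrightarrow> h p \<le> g p + e"
  shows "copula_integral C h \<le> copula_integral C g + e"
proof -
  interpret prob_space "copula_measure C" by (rule prob_space_copula_measure[OF C])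
  have const: "set_integrable (copula_measure C) half_open_square (\<lambda>_. e)"
    using half_open_square_sets[OF C] by (simp add: set_integrable_def emeasure_eq_measure)
  have "copula_integral C h \<le> (LINT p:half_open_square|copula_measure C. g p + e)"
    unfolding copula_integral_def using g const le
    by (intro set_integral_mono[OF h set_integral_add(1)]) auto
  also have "\<dots> = copula_integral C g + (LINT p:half_open_square|copula_measure C. e)"
    unfolding copula_integral_def by (rule set_integral_add(2)[OF g const])
  also have "(LINT p:half_open_square|copula_measure C. e) = prob half_open_square * e"
    using half_open_square_sets[OF C] by (simp add: set_lebesgue_integral_def)
  also have "\<dots> \<le> e"
    using e by (simp add: mult_left_le_one_le)
  finally show ?thesis by simp
qed

section \<open>Dyadic approximation\<close>

text \<open>The \<open>+ 1\<close> matches the numbering of the dyadic intervals from 1.\<close>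

definition dyadic_index :: "nat \<Rightarrow> real \<Rightarrow> nat" where
  "dyadic_index n x = nat \<lfloor>2 ^ n * x\<rfloor> + 1"

lemma dyadic_index:
  assumes "x \<in> {0..<1}"
  shows "dyadic_index n x \<in> {1..2 ^ n}"
    "x \<in> {(real (dyadic_index n x) - 1) / 2 ^ n ..< real (dyadic_index n x) / 2 ^ n}"
proof -
  have "\<lfloor>2 ^ n * x\<rfloor> < 2 ^ n"
    using assms by (simp add: floor_less_iff)
  then show "dyadic_index n x \<in> {1..2 ^ n}"
    using assms by (auto simp: dyadic_index_def nat_less_iff Suc_le_eq)
  have "0 \<le> \<lfloor>2 ^ n * x\<rfloor>" using assms by simp
  then have "real (nat \<lfloor>2 ^ n * x\<rfloor>) = of_int \<lfloor>2 ^ n * x\<rfloor>" by simp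
  then show "x \<in> {(real (dyadic_index n x) - 1) / 2 ^ n ..< real (dyadic_index n x) / 2 ^ n}"
    using of_int_floor_le[of "2 ^ n * x"] real_of_int_floor_add_one_gt[of "2 ^ n * x"]
    by (simp add: dyadic_index_def divide_le_eq less_divide_eq mult.commute[of x] add.commute[of 1])
qed

lemma dyadic_square_index:
  assumes "p \<in> half_open_square"
  shows "p \<in> dyadic_square n (dyadic_index n (fst p)) (dyadic_index n (snd p))"
  using dyadic_index(2)[of "fst p" n] dyadic_index(2)[of "snd p" n] assms
  by (auto simp: dyadic_square_def)

lemma dyadic_square_subset:
  assumes "i \<in> {1..2 ^ n}" "j \<in> {1..2 ^ n}"
  shows "dyadic_square n i j \<subseteq> half_open_square"
proof -
  have *: "{(real k - 1) / 2 ^ n ..< real k / 2 ^ n} \<subseteq> {0..<1}" if "k \<in> {1..2 ^ n}" for k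
  proof -
    have "0 \<le> (real k - 1) / 2 ^ n" using that by simp
    moreover have "real k / 2 ^ n \<le> 1"
      using that of_nat_le_iff[of k "2 ^ n", where 'a = real] by simp
    ultimately show ?thesis by (auto intro: order_trans less_le_trans)
  qed
  show ?thesis
    unfolding dyadic_square_def using *[OF assms(1)] *[OF assms(2)] by blast
qed

text \<open>The Euclidean distance is at most the sum of the coordinate distances, each bounded by
  the side length.\<close>

lemma dyadic_square_dist:
  assumes "p \<in> dyadic_square n i j" "q \<in> dyadic_square n i j"
  shows "dist p q \<le> 2 / 2 ^ n"
proof -
  have *: "dist x y \<le> 1 / 2 ^ n"
    if "x \<in> {(real k - 1) / 2 ^ n ..< real k / 2 ^ n}" "y \<in> {(real k - 1) / 2 ^ n ..< real k / 2 ^ n}"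
    for x y :: real and k
    using that by (auto simp: dist_real_def abs_le_iff diff_divide_distrib)
  have "dist p q \<le> dist (fst p) (fst q) + dist (snd p) (snd q)"
    unfolding dist_prod_def by (rule sqrt_sum_squares_le_sum) auto
  also have "\<dots> \<le> 1 / 2 ^ n + 1 / 2 ^ n"
    using assms by (intro add_mono *) (auto simp: dyadic_square_def)
  finally show ?thesis by simp
qed

text \<open>The indices are measurable with countably many values, so the cell values
  \<open>c\<close> may be arbitrary.\<close>

lemma measurable_dyadic_step:
  fixes c :: "nat \<Rightarrow> nat \<Rightarrow> real"
  shows "(\<lambda>p. c (dyadic_index n (fst p)) (dyadic_index n (snd p)))
    \<in> borel_measurable (restrict_space borel unit_square)"
proof (rule measurable_restrict_space1)
  have index: "dyadic_index n \<in> measurable borel (count_space UNIV)"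
    unfolding dyadic_index_def by measurable
  have proj: "(fst :: real \<times> real \<Rightarrow> real) \<in> borel_measurable borel"
    "(snd :: real \<times> real \<Rightarrow> real) \<in> borel_measurable borel"
    by (intro borel_measurable_continuous_onI continuous_intros)+
  note idx = measurable_compose[OF proj(1) index] measurable_compose[OF proj(2) index]
  show "(\<lambda>p. c (dyadic_index n (fst p)) (dyadic_index n (snd p))) \<in> borel_measurable borel"
    by (rule measurable_compose_countable[where f = "\<lambda>i p. c i (dyadic_index n (snd p))", OF _ idx(1)])
      (rule measurable_compose[OF idx(2)], simp)
qed

text \<open>The bound \<open>B\<close> ensures that the real infimum and supremum are genuine. The
  conclusion combines \<open>B\<close>, used for integrability, with the oscillation
  \<open>e\<close>, used for convergence.\<close>

lemma dyadic_square_extrema: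
  fixes f :: "real \<times> real \<Rightarrow> real"
  assumes B: "\<And>p. p \<in> unit_square \<Longrightarrow> \<bar>f p\<bar> \<le> B"
    and ij: "i \<in> {1..2 ^ n}" "j \<in> {1..2 ^ n}" and p: "p \<in> dyadic_square n i j"
    and e: "\<And>q. q \<in> dyadic_square n i j \<Longrightarrow> \<bar>f p - f q\<bar> \<le> e"
  shows "(INF q\<in>dyadic_square n i j. f q) \<in> {max (- B) (f p - e)..f p}"
    and "(SUP q\<in>dyadic_square n i j. f q) \<in> {f p..min B (f p + e)}"
proof -
  let ?D = "dyadic_square n i j"
  have "?D \<subseteq> unit_square"
    using dyadic_square_subset[OF ij] by force
  then have bounds: "- B \<le> f q" "f q \<le> B" if "q \<in> ?D" for q
    using B[of q] subsetD[OF _ that, of unit_square] by (simp_all only: abs_le_iff minus_le_iff)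
  have ne: "?D \<noteq> {}" using p by auto
  have "bdd_below (f ` ?D)" "bdd_above (f ` ?D)"
    using bounds by (auto intro!: bdd_belowI[of _ "- B"] bdd_aboveI[of _ B])
  then have "(INF q\<in>?D. f q) \<le> f p" "f p \<le> (SUP q\<in>?D. f q)"
    using p by (auto intro: cINF_lower cSUP_upper)
  moreover have "max (- B) (f p - e) \<le> (INF q\<in>?D. f q)"
    by (rule cINF_greatest[OF ne]) (use e bounds in \<open>force simp: abs_le_iff\<close>)
  moreover have "(SUP q\<in>?D. f q) \<le> min B (f p + e)"
    by (rule cSUP_least[OF ne]) (use e bounds in \<open>force simp: abs_le_iff\<close>)
  ultimately show "(INF q\<in>?D. f q) \<in> {max (- B) (f p - e)..f p}"
    and "(SUP q\<in>?D. f q) \<in> {f p..min B (f p + e)}"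
    by auto
qed

section \<open>Enclosure of the supremum and convergence of the maximal integrals\<close>

theorem theorem5p1p6:
  fixes f :: "real \<times> real \<Rightarrow> real"
    and f_lo f_up :: "nat \<Rightarrow> real \<times> real \<Rightarrow> real"
    and C_lo C_up :: "nat \<Rightarrow> real \<times> real \<Rightarrow> real"
  assumes "continuous_on unit_square f"
    and "\<And>n i j p. \<lbrakk>n > 1; i \<in> {1..2 ^ n}; j \<in> {1..2 ^ n}; p \<in> dyadic_square n i j\<rbrakk>
           \<Longrightarrow> f_lo n p = (INF q\<in>dyadic_square n i j. f q)"
    and "\<And>n i j p. \<lbrakk>n > 1; i \<in> {1..2 ^ n}; j \<in> {1..2 ^ n}; p \<in> dyadic_square n i j\<rbrakk>
           \<Longrightarrow> f_up n p = (SUP q\<in>dyadic_square n i j. f q)"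
    and "\<And>n. n > 1 \<Longrightarrow>
           is_arg_max (\<lambda>C. copula_integral C (f_lo n)) (\<lambda>C. C \<in> copulas) (C_lo n)"
    and "\<And>n. n > 1 \<Longrightarrow>
           is_arg_max (\<lambda>C. copula_integral C (f_up n)) (\<lambda>C. C \<in> copulas) (C_up n)"
  shows "(\<forall>n>1. copula_integral (C_lo n) (f_lo n) \<le> (SUP C\<in>copulas. copula_integral C f) \<and>
            (SUP C\<in>copulas. copula_integral C f) \<le> copula_integral (C_up n) (f_up n)) \<and>
         (\<lambda>n. copula_integral (C_lo n) (f_lo n)) \<longlonglongrightarrow> (SUP C\<in>copulas. copula_integral C f) \<and>
         (\<lambda>n. copula_integral (C_up n) (f_up n)) \<longlonglongrightarrow> (SUP C\<in>copulas. copula_integral C f)"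
proof -
  let ?V = "SUP C\<in>copulas. copula_integral C f"
  have "compact (f ` unit_square)"
    by (intro compact_continuous_image[OF assms(1)] compact_Times) auto
  then have "bounded (f ` unit_square)"
    by (rule compact_imp_bounded)
  then obtain B where B: "\<And>p. p \<in> unit_square \<Longrightarrow> \<bar>f p\<bar> \<le> B"
    unfolding bounded_iff real_norm_def by blast
  have sub: "half_open_square \<subseteq> unit_square" by force
  have B': "\<bar>f p\<bar> \<le> B" if "p \<in> half_open_square" for p
    using B sub that by blast
  have index: "dyadic_index n (fst p) \<in> {1..2 ^ n}" "dyadic_index n (snd p) \<in> {1..2 ^ n}"
    if "p \<in> half_open_square" for n p
    using dyadic_index(1)[of "fst p" n] dyadic_index(1)[of "snd p" n] that
    by (simp_all only: mem_Times_iff)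

  have f_int: "set_integrable (copula_measure C) half_open_square f" if "C \<in> copulas" for C
    by (rule set_integrable_copula_measure[OF that
          borel_measurable_continuous_on_restrict[OF assms(1)] refl B'])
  \<comment> \<open>The premise on \<open>e\<close> concerns points within \<open>2 / 2 ^ n\<close>,
    the bound on distances in a cell; it is met below by a trivial \<open>e\<close> for every
    \<open>n\<close> and by a small \<open>e\<close> for large \<open>n\<close>.\<close>
  have bounds: "f_lo n p \<in> {max (- B) (f p - e)..f p}" "f_up n p \<in> {f p..min B (f p + e)}"
    if n: "n > 1" and p: "p \<in> half_open_square"
      and e: "\<And>q. q \<in> half_open_square \<Longrightarrow> dist p q \<le> 2 / 2 ^ n \<Longrightarrow> \<bar>f p - f q\<bar> \<le> e"
    for n p e
  proof -
    have "\<bar>f p - f q\<bar> \<le> e"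
      if "q \<in> dyadic_square n (dyadic_index n (fst p)) (dyadic_index n (snd p))" for q
      using dyadic_square_subset[OF index[OF p]] dyadic_square_dist[OF dyadic_square_index[OF p] that]
      by (intro e subsetD[OF _ that])
    from dyadic_square_extrema[where f = f and e = e and n = n, OF B index[OF p] dyadic_square_index[OF p] this]
    show "f_lo n p \<in> {max (- B) (f p - e)..f p}" "f_up n p \<in> {f p..min B (f p + e)}"
      using assms(2,3)[OF n index[OF p] dyadic_square_index[OF p]] by simp_all
  qed
  have coarse: "f_lo n p \<in> {- B..f p}" "f_up n p \<in> {f p..B}"
    if n: "n > 1" and p: "p \<in> half_open_square" for n p
  proof -
    \<comment> \<open>The trivial oscillation bound, valid at every scale.\<close>
    have "\<bar>f p - f q\<bar> \<le> 2 * B" if "q \<in> half_open_square" for q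
      using B'[OF p] B'[OF that] by linarith
    from bounds[OF n p this] show "f_lo n p \<in> {- B..f p}" "f_up n p \<in> {f p..B}" by auto
  qed
  have lo_int: "set_integrable (copula_measure C) half_open_square (f_lo n)"
    and up_int: "set_integrable (copula_measure C) half_open_square (f_up n)"
    if C: "C \<in> copulas" and n: "n > 1" for C n
  proof -
    have "\<bar>f_lo n p\<bar> \<le> B" "\<bar>f_up n p\<bar> \<le> B" if "p \<in> half_open_square" for p
      using coarse[OF n that] B'[OF that] by auto
    note B_n = this
    have step: "f_lo n p = (INF q\<in>dyadic_square n (dyadic_index n (fst p)) (dyadic_index n (snd p)). f q)"
      "f_up n p = (SUP q\<in>dyadic_square n (dyadic_index n (fst p)) (dyadic_index n (snd p)). f q)"
      if "p \<in> half_open_square" for p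
      using assms(2,3)[OF n index[OF that] dyadic_square_index[OF that]] by auto
    show "set_integrable (copula_measure C) half_open_square (f_lo n)"
      by (rule set_integrable_copula_measure[where B = B, OF C measurable_dyadic_step[of
              "\<lambda>i j. INF q\<in>dyadic_square n i j. f q" n]])
        (erule step(1) B_n(1))+
    show "set_integrable (copula_measure C) half_open_square (f_up n)"
      by (rule set_integrable_copula_measure[where B = B, OF C measurable_dyadic_step[of
              "\<lambda>i j. SUP q\<in>dyadic_square n i j. f q" n]])
        (erule step(2) B_n(2))+
  qed

  have lo: "C_lo n \<in> copulas" "C \<in> copulas \<Longrightarrow> copula_integral C (f_lo n) \<le> copula_integral (C_lo n) (f_lo n)"
    and up: "C_up n \<in> copulas" "C \<in> copulas \<Longrightarrow> copula_integral C (f_up n) \<le> copula_integral (C_up n) (f_up n)"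
    if "n > 1" for C n
    using assms(4,5)[OF that] by (auto simp: is_arg_max_def not_less)
  have ne: "copulas \<noteq> {}" using lo(1)[of 2] by auto
  \<comment> \<open>Comparison with the zero function. The resulting bound makes the supremum over
    all copulas a genuine one.\<close>
  have "copula_integral C f \<le> B" if C: "C \<in> copulas" for C
  proof -
    have "f p \<le> 0 + B" if "p \<in> half_open_square" for p
      using B'[OF that] by linarith
    moreover have "0 \<le> B" using B'[of "(0, 0)"] by auto
    ultimately have "copula_integral C f \<le> copula_integral C (\<lambda>_. 0) + B"
      by (intro copula_integral_le_add[OF C _ f_int[OF C]]) (simp add: set_integrable_def)
    then show ?thesis by (simp add: copula_integral_def set_lebesgue_integral_def)
  qed
  then have bdd: "bdd_above ((\<lambda>C. copula_integral C f) ` copulas)"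
    by (auto intro!: bdd_aboveI)

  have lo_le: "copula_integral (C_lo n) (f_lo n) \<le> ?V" if n: "n > 1" for n
  proof -
    have "copula_integral (C_lo n) (f_lo n) \<le> copula_integral (C_lo n) f + 0"
      using coarse(1)[OF n]
      by (intro copula_integral_le_add lo(1) n f_int lo_int)
        (simp_all del: mem_Times_iff)
    also have "\<dots> \<le> ?V"
      using cSUP_upper[OF lo(1)[OF n] bdd] by simp
    finally show ?thesis .
  qed
  have le_up: "?V \<le> copula_integral (C_up n) (f_up n)" if n: "n > 1" for n
  proof (rule cSUP_least[OF ne])
    fix C :: "real \<times> real \<Rightarrow> real" assume C: "C \<in> copulas"
    have "copula_integral C f \<le> copula_integral C (f_up n) + 0"
      using coarse(2)[OF n]
      by (intro copula_integral_le_add C n f_int up_int) (simp_all del: mem_Times_iff)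
    then show "copula_integral C f \<le> copula_integral (C_up n) (f_up n)"
      using up(2)[OF n C] by simp
  qed
  \<comment> \<open>For fine cells, any copula integrates \<open>f\<close> to at most
    \<open>e\<close> more than \<open>f_lo n\<close>, hence to at most \<open>e\<close> more than
    the maximum at \<open>C_lo n\<close>. Dually, \<open>C_up n\<close> is itself a competitor in
    the supremum for \<open>f\<close>.\<close>
  have close: "\<forall>\<^sub>F n in sequentially. ?V \<le> copula_integral (C_lo n) (f_lo n) + e \<and>
      copula_integral (C_up n) (f_up n) \<le> ?V + e" if e: "0 < e" for e
  proof -
    have "uniformly_continuous_on unit_square f"
      by (intro compact_uniformly_continuous[OF assms(1)] compact_Times) auto
    then obtain d where d: "0 < d"
      "\<And>p q. p \<in> unit_square \<Longrightarrow> q \<in> unit_square \<Longrightarrow> dist q p < d \<Longrightarrow> dist (f q) (f p) < e"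
      using e unfolding uniformly_continuous_on_def by metis
    have "(\<lambda>n. 2 / 2 ^ n :: real) \<longlonglongrightarrow> 0"
      by (rule LIMSEQ_divide_realpow_zero) simp
    then have "\<forall>\<^sub>F n in sequentially. 2 / 2 ^ n < d"
      using d(1) by (rule order_tendstoD)
    then show ?thesis
      using eventually_gt_at_top[of 1]
    proof eventually_elim
      case (elim n)
      then have n: "n > 1" by simp
      have fine: "f_lo n p \<in> {max (- B) (f p - e)..f p}" "f_up n p \<in> {f p..min B (f p + e)}"
        if p: "p \<in> half_open_square" for p
      proof -
        have "\<bar>f p - f q\<bar> \<le> e" if "q \<in> half_open_square" "dist p q \<le> 2 / 2 ^ n" for q
          using d(2)[OF subsetD[OF sub that(1)] subsetD[OF sub p]] that(2) elim(1)
          by (simp add: dist_real_def)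
        from bounds[OF n p this] show "f_lo n p \<in> {max (- B) (f p - e)..f p}"
          "f_up n p \<in> {f p..min B (f p + e)}" by auto
      qed
      have "?V \<le> copula_integral (C_lo n) (f_lo n) + e"
      proof (rule cSUP_least[OF ne])
        fix C :: "real \<times> real \<Rightarrow> real" assume C: "C \<in> copulas"
        have "copula_integral C f \<le> copula_integral C (f_lo n) + e"
          using fine(1) e
          by (intro copula_integral_le_add C n f_int lo_int) (fastforce simp del: mem_Times_iff)+
        then show "copula_integral C f \<le> copula_integral (C_lo n) (f_lo n) + e"
          using lo(2)[OF n C] by simp
      qed
      moreover have "copula_integral (C_up n) (f_up n) \<le> copula_integral (C_up n) f + e"
        using fine(2) e
        by (intro copula_integral_le_add up(1) n f_int up_int) (fastforce simp del: mem_Times_iff)+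
      moreover have "copula_integral (C_up n) f \<le> ?V"
        by (rule cSUP_upper[OF up(1)[OF n] bdd])
      ultimately show ?case by simp
    qed
  qed
  have "(\<lambda>n. copula_integral (C_lo n) (f_lo n)) \<longlonglongrightarrow> ?V"
  proof (rule tendstoI)
    fix e :: real assume "0 < e"
    \<comment> \<open>Halving \<open>e\<close> turns the non-strict estimate into the strict one
      that convergence demands.\<close>
    then have "\<forall>\<^sub>F n in sequentially. ?V \<le> copula_integral (C_lo n) (f_lo n) + e / 2"
      using close[of "e / 2"] by (simp add: eventually_conj_iff)
    then show "\<forall>\<^sub>F n in sequentially. dist (copula_integral (C_lo n) (f_lo n)) ?V < e"
      using eventually_gt_at_top[of 1]
    proof eventually_elim
      case (elim n)
      then show ?case using lo_le[of n] \<open>0 < e\<close> by (simp add: dist_real_def)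
    qed
  qed
  moreover have "(\<lambda>n. copula_integral (C_up n) (f_up n)) \<longlonglongrightarrow> ?V"
  proof (rule tendstoI)
    fix e :: real assume "0 < e"
    then have "\<forall>\<^sub>F n in sequentially. copula_integral (C_up n) (f_up n) \<le> ?V + e / 2"
      using close[of "e / 2"] by (simp add: eventually_conj_iff)
    then show "\<forall>\<^sub>F n in sequentially. dist (copula_integral (C_up n) (f_up n)) ?V < e"
      using eventually_gt_at_top[of 1]
    proof eventually_elim
      case (elim n)
      then show ?case using le_up[of n] \<open>0 < e\<close> by (simp add: dist_real_def)
    qed
  qed
  ultimately show ?thesis
    using lo_le le_up by blast
qed

end
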